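(* Let $(\mathfrak{g},B)$ be an odd quadratic Lie superalgebra of dimension 4 such that $\mathfrak{g}_{\overline 0}$ is non-Abelian. Then $\mathfrak{g}$ is i-isomorphic to the odd quadratic Lie superalgebra with even basis $\{X_{\overline 0},Y_{\overline 0}\}$, odd basis $\{X_{\overline 1},Y_{\overline 1}\}$, odd form given by $B(X_{\overline 0},X_{\overline 1})=B(Y_{\overline 0},Y_{\overline 1})=1$ (zero on other pairs of basis vectors), and nonzero brackets $$[X_{\overline 0},Y_{\overline 0}]=Y_{\overline 0},\quad [X_{\overline 0},Y_{\overline 1}]=-Y_{\overline 1},\quad [Y_{\overline 0},Y_{\overline 1}]=X_{\overline 1}.$$
   Context: All vector spaces are finite-dimensional over $\mathbb{C}$. An odd quadratic Lie superalgebra is a Lie superalgebra $\mathfrak{g}=\mathfrak{g}_{\overline 0}\oplus\mathfrak{g}_{\overline 1}$ with a non-degenerate bilinear form $B$ that is supersymmetric ($B(Y,X)=(-1)^{xy}B(X,Y)$ for $X\in\mathfrak{g}_x$, $Y\in\mathfrak{g}_y$), invariant ($B([X,Y],Z)=B(X,[Y,Z])$), and odd ($B(\mathfrak{g}_\alpha,\mathfrak{g}_\alpha)=0$ for $\alpha\in\mathbb{Z}_2$). An i-isomorphism is an (even) Lie superalgebra isomorphism preserving the bilinear forms. Brackets are listed up to super skew-symmetry. *)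

theory Defs
  imports "HOL-Analysis.Analysis" "HOL-Library.Z2"
begin

definition super_sign :: "bit \<Rightarrow> bit \<Rightarrow> complex" where
  "super_sign x y = (if x * y = 1 then - 1 else 1)"

locale lie_superalgebra = vector_space scale
  for scale :: "complex \<Rightarrow> 'v::ab_group_add \<Rightarrow> 'v" +
  fixes part :: "bit \<Rightarrow> 'v set"
    and bracket :: "'v \<Rightarrow> 'v \<Rightarrow> 'v"
  assumes finite_dimensional: "\<exists>S. finite S \<and> span S = UNIV"
    and subspace_part: "subspace (part x)"
    and part_sum: "\<exists>u\<in>part 0. \<exists>w\<in>part 1. v = u + w"
    and part_inter: "part 0 \<inter> part 1 = {0}"
    and bracket_linear_left: "Vector_Spaces.linear scale scale (\<lambda>u. bracket u v)"
    and bracket_linear_right: "Vector_Spaces.linear scale scale (\<lambda>u. bracket v u)"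
    and bracket_grading:
      "\<lbrakk>X \<in> part x; Y \<in> part y\<rbrakk> \<Longrightarrow> bracket X Y \<in> part (x + y)"
    and bracket_super_skew:
      "\<lbrakk>X \<in> part x; Y \<in> part y\<rbrakk> \<Longrightarrow> bracket Y X = - scale (super_sign x y) (bracket X Y)"
    and super_jacobi:
      "\<lbrakk>X \<in> part x; Y \<in> part y; Z \<in> part z\<rbrakk> \<Longrightarrow>
         scale (super_sign x z) (bracket (bracket X Y) Z)
       + scale (super_sign x y) (bracket (bracket Y Z) X)
       + scale (super_sign y z) (bracket (bracket Z X) Y) = 0"

locale odd_quadratic_lie_superalgebra = lie_superalgebra scale part bracket
  for scale :: "complex \<Rightarrow> 'v::ab_group_add \<Rightarrow> 'v"
    and part :: "bit \<Rightarrow> 'v set"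
    and bracket :: "'v \<Rightarrow> 'v \<Rightarrow> 'v" +
  fixes form :: "'v \<Rightarrow> 'v \<Rightarrow> complex"
  assumes form_linear_left: "Vector_Spaces.linear scale (*) (\<lambda>u. form u v)"
    and form_linear_right: "Vector_Spaces.linear scale (*) (\<lambda>u. form v u)"
    and form_supersymmetric:
      "\<lbrakk>X \<in> part x; Y \<in> part y\<rbrakk> \<Longrightarrow> form Y X = super_sign x y * form X Y"
    and form_nondegenerate: "(\<And>Y. form X Y = 0) \<Longrightarrow> X = 0"
    and form_invariant: "form (bracket X Y) Z = form X (bracket Y Z)"
    and form_odd: "\<lbrakk>X \<in> part x; Y \<in> part x\<rbrakk> \<Longrightarrow> form X Y = 0"

text \<open>The objects on both sides are required to be odd quadratic Lie superalgebras, so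
  i-isomorphy to a concrete model includes that the model is one.\<close>

definition i_isomorphic ::
  "(complex \<Rightarrow> 'v::ab_group_add \<Rightarrow> 'v) \<Rightarrow> (bit \<Rightarrow> 'v set) \<Rightarrow> ('v \<Rightarrow> 'v \<Rightarrow> 'v) \<Rightarrow> ('v \<Rightarrow> 'v \<Rightarrow> complex) \<Rightarrow>
   (complex \<Rightarrow> 'w::ab_group_add \<Rightarrow> 'w) \<Rightarrow> (bit \<Rightarrow> 'w set) \<Rightarrow> ('w \<Rightarrow> 'w \<Rightarrow> 'w) \<Rightarrow> ('w \<Rightarrow> 'w \<Rightarrow> complex) \<Rightarrow> bool"
where
  "i_isomorphic s g br B s' g' br' B' \<longleftrightarrow>
     odd_quadratic_lie_superalgebra s g br B \<and>
     odd_quadratic_lie_superalgebra s' g' br' B' \<and>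
     (\<exists>f. Vector_Spaces.linear s s' f \<and> bij f \<and> (\<forall>x. f ` g x \<subseteq> g' x) \<and>
          (\<forall>u v. f (br u v) = br' (f u) (f v)) \<and>
          (\<forall>u v. B' (f u) (f v) = B u v))"

text \<open>The model has underlying space \<open>\<complex>\<close> to the power of the following four-element index type,
  whose elements name the standard basis vectors.\<close>

datatype gen = X0 | Y0 | X1 | Y1

lemma UNIV_gen: "UNIV = {X0, Y0, X1, Y1}"
  by (auto intro: gen.exhaust)

instance gen :: finite
  by standard (simp add: UNIV_gen)

abbreviation basis_vec :: "gen \<Rightarrow> complex ^ gen" where
  "basis_vec i \<equiv> axis i 1"

definition model_part :: "bit \<Rightarrow> (complex ^ gen) set" where
  "model_part x = (if x = 0 then vec.span {basis_vec X0, basis_vec Y0}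
                   else vec.span {basis_vec X1, basis_vec Y1})"

text \<open>The brackets of basis vectors, including those determined by super skew-symmetry.\<close>

fun bracket_table :: "gen \<Rightarrow> gen \<Rightarrow> complex ^ gen" where
  "bracket_table X0 Y0 = basis_vec Y0"
| "bracket_table Y0 X0 = - basis_vec Y0"
| "bracket_table X0 Y1 = - basis_vec Y1"
| "bracket_table Y1 X0 = basis_vec Y1"
| "bracket_table Y0 Y1 = basis_vec X1"
| "bracket_table Y1 Y0 = - basis_vec X1"
| "bracket_table _ _ = 0"

fun form_table :: "gen \<Rightarrow> gen \<Rightarrow> complex" where
  "form_table X0 X1 = 1"
| "form_table X1 X0 = 1"
| "form_table Y0 Y1 = 1"
| "form_table Y1 Y0 = 1"
| "form_table _ _ = 0"

definition model_bracket :: "complex ^ gen \<Rightarrow> complex ^ gen \<Rightarrow> complex ^ gen" where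
  "model_bracket u v = (\<Sum>i\<in>UNIV. \<Sum>j\<in>UNIV. (u $ i * v $ j) *s bracket_table i j)"

definition model_form :: "complex ^ gen \<Rightarrow> complex ^ gen \<Rightarrow> complex" where
  "model_form u v = (\<Sum>i\<in>UNIV. \<Sum>j\<in>UNIV. u $ i * v $ j * form_table i j)"

end

theory Submission
  imports Defs
begin

text \<open>The form pairs \<open>\<gg> 0\<close> with \<open>\<gg> 1\<close>, so both have dimension 2, and a non-Abelian \<open>\<gg> 0\<close> has a basis
  with \<open>[x0, y0] = y0\<close>. In the dual basis \<open>x1, y1\<close> of \<open>\<gg> 1\<close>, invariance of the form determines the
  brackets between even and odd vectors. The bracket of two odd vectors corresponds to an
  invariant cubic form on \<open>\<gg> 1\<close>; the weight of \<open>x0\<close> leaves only the cube of the coordinate dual to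
  \<open>x1\<close>, which is not invariant under \<open>y0\<close>, so this bracket vanishes.\<close>

section \<open>The model in coordinates\<close>

lemma sum_gen: "(\<Sum>i\<in>UNIV. h i) = h X0 + h Y0 + h X1 + h Y1"
  for h :: "gen \<Rightarrow> 'a::comm_monoid_add"
  by (simp add: UNIV_gen add.assoc)

lemma all_gen: "(\<forall>i. P i) \<longleftrightarrow> P X0 \<and> P Y0 \<and> P X1 \<and> P Y1"
  by (metis gen.exhaust)

text \<open>Coordinatewise, the axioms for the model become polynomial identities in four named
  entries per vector, which simplification can verify.\<close>

lemma model_bracket_nth:
  "model_bracket u v $ X0 = 0"
  "model_bracket u v $ Y0 = u $ X0 * v $ Y0 - u $ Y0 * v $ X0"
  "model_bracket u v $ X1 = u $ Y0 * v $ Y1 - u $ Y1 * v $ Y0"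
  "model_bracket u v $ Y1 = u $ Y1 * v $ X0 - u $ X0 * v $ Y1"
  by (simp_all add: model_bracket_def sum_gen axis_def)

lemma model_form_eq:
  "model_form u v = u $ X0 * v $ X1 + u $ X1 * v $ X0 + u $ Y0 * v $ Y1 + u $ Y1 * v $ Y0"
  by (simp add: model_form_def sum_gen)

text \<open>Replaces the span by vanishing coordinates, so that the axioms about homogeneous vectors
  can be checked one combination of parities at a time.\<close>

lemma mem_model_part_0: "v \<in> model_part 0 \<longleftrightarrow> v $ X1 = 0 \<and> v $ Y1 = 0"
proof
  assume "v $ X1 = 0 \<and> v $ Y1 = 0"
  then have "v = v $ X0 *s basis_vec X0 + v $ Y0 *s basis_vec Y0"
    by (simp add: vec_eq_iff all_gen axis_def)
  moreover have "\<dots> \<in> vec.span {basis_vec X0, basis_vec Y0}"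
    by (intro vec.span_add vec.span_scale vec.span_base) auto
  ultimately show "v \<in> model_part 0"
    by (simp add: model_part_def)
qed (auto simp: model_part_def vec.span_insert axis_def algebra_simps vec_eq_iff all_gen)

lemma mem_model_part_1: "v \<in> model_part 1 \<longleftrightarrow> v $ X0 = 0 \<and> v $ Y0 = 0"
proof
  assume "v $ X0 = 0 \<and> v $ Y0 = 0"
  then have "v = v $ X1 *s basis_vec X1 + v $ Y1 *s basis_vec Y1"
    by (simp add: vec_eq_iff all_gen axis_def)
  moreover have "\<dots> \<in> vec.span {basis_vec X1, basis_vec Y1}"
    by (intro vec.span_add vec.span_scale vec.span_base) auto
  ultimately show "v \<in> model_part 1"
    by (simp add: model_part_def)
qed (auto simp: model_part_def vec.span_insert axis_def algebra_simps vec_eq_iff all_gen)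

lemma model_lie_superalgebra: "lie_superalgebra (*s) model_part model_bracket"
proof (intro lie_superalgebra.intro lie_superalgebra_axioms.intro)
  show "vector_space ((*s) :: complex \<Rightarrow> complex ^ gen \<Rightarrow> _)"
    by (rule vec.vector_space_axioms)
  show "\<exists>S. finite S \<and> vec.span S = (UNIV :: (complex ^ gen) set)"
    using finite_cart_basis span_cart_basis by blast
  show "vec.subspace (model_part x)" for x
    by (simp add: model_part_def)
  show "\<exists>u\<in>model_part 0. \<exists>w\<in>model_part 1. v = u + w" for v
  proof (intro bexI)
    show "v = (\<chi> i. if i = X0 \<or> i = Y0 then v $ i else 0)
            + (\<chi> i. if i = X0 \<or> i = Y0 then 0 else v $ i)"
      by (simp add: vec_eq_iff)
  qed (simp_all add: mem_model_part_0 mem_model_part_1)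
  show "model_part 0 \<inter> model_part 1 = {0}"
    by (auto simp: mem_model_part_0 mem_model_part_1 vec_eq_iff all_gen)
  show "Vector_Spaces.linear (*s) (*s) (\<lambda>u. model_bracket u v)" for v
    by unfold_locales
      (simp_all add: vec_eq_iff all_gen model_bracket_nth algebra_simps)
  show "Vector_Spaces.linear (*s) (*s) (\<lambda>u. model_bracket v u)" for v
    by unfold_locales
      (simp_all add: vec_eq_iff all_gen model_bracket_nth algebra_simps)
  show "model_bracket u v \<in> model_part (x + y)"
    if "u \<in> model_part x" "v \<in> model_part y" for u v x y
    using that by (cases x; cases y)
      (simp_all add: mem_model_part_0 mem_model_part_1 model_bracket_nth)
  show "model_bracket v u = - (super_sign x y *s model_bracket u v)"
    if "u \<in> model_part x" "v \<in> model_part y" for u v x y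
    using that by (cases x; cases y)
      (simp_all add: mem_model_part_0 mem_model_part_1 model_bracket_nth super_sign_def
        vec_eq_iff all_gen)
  show "super_sign x z *s model_bracket (model_bracket u v) w
      + super_sign x y *s model_bracket (model_bracket v w) u
      + super_sign y z *s model_bracket (model_bracket w u) v = 0"
    if "u \<in> model_part x" "v \<in> model_part y" "w \<in> model_part z" for u v w x y z
    using that by (cases x; cases y; cases z)
      (simp_all add: mem_model_part_0 mem_model_part_1 model_bracket_nth super_sign_def
        vec_eq_iff all_gen algebra_simps)
qed

lemma model_odd_quadratic:
  "odd_quadratic_lie_superalgebra (*s) model_part model_bracket model_form"
proof (intro odd_quadratic_lie_superalgebra.intro odd_quadratic_lie_superalgebra_axioms.intro)
  show "lie_superalgebra (*s) model_part model_bracket"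
    by (rule model_lie_superalgebra)
  show "Vector_Spaces.linear (*s) (*) (\<lambda>u. model_form u v)" for v
    by unfold_locales (simp_all add: model_form_eq algebra_simps)
  show "Vector_Spaces.linear (*s) (*) (\<lambda>u. model_form v u)" for v
    by unfold_locales (simp_all add: model_form_eq algebra_simps)
  show "model_form v u = super_sign x y * model_form u v"
    if "u \<in> model_part x" "v \<in> model_part y" for u v x y
    using that by (cases x; cases y)
      (simp_all add: mem_model_part_0 mem_model_part_1 model_form_eq super_sign_def)
  show "u = 0" if "\<And>v. model_form u v = 0" for u
    \<comment> \<open>Pairing with a basis vector returns the coordinate of \<open>u\<close> at the
      dual index, so these four pairings exhaust the coordinates.\<close>
    using that[of "basis_vec X0"] that[of "basis_vec Y0"]
      that[of "basis_vec X1"] that[of "basis_vec Y1"]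
    by (simp add: model_form_eq axis_def vec_eq_iff all_gen)
  show "model_form (model_bracket u v) w = model_form u (model_bracket v w)" for u v w
    by (simp add: model_form_eq model_bracket_nth algebra_simps)
  show "model_form u v = 0" if "u \<in> model_part x" "v \<in> model_part x" for u v x
    using that by (cases x) (simp_all add: mem_model_part_0 mem_model_part_1 model_form_eq)
qed

section \<open>The even part and its bracket\<close>

context lie_superalgebra
begin

lemmas bracket_left = bracket_linear_left[unfolded linear_iff_module_hom]
lemmas bracket_right = bracket_linear_right[unfolded linear_iff_module_hom]

lemmas bracket_simps =
  module_hom.add[OF bracket_left] module_hom.add[OF bracket_right]
  module_hom.scale[OF bracket_left] module_hom.scale[OF bracket_right]
  module_hom.diff[OF bracket_left] module_hom.diff[OF bracket_right]
  module_hom.neg[OF bracket_left] module_hom.neg[OF bracket_right]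
  module_hom.zero[OF bracket_left] module_hom.zero[OF bracket_right]

lemma bracket_skew: "\<lbrakk>u \<in> part 0; v \<in> part x\<rbrakk> \<Longrightarrow> bracket v u = - bracket u v"
  using bracket_super_skew[of u 0 v x] by (simp add: super_sign_def)

lemma bracket_even_self: "u \<in> part 0 \<Longrightarrow> bracket u u = 0"
proof -
  assume "u \<in> part 0"
  then have "bracket u u = - bracket u u"
    by (rule bracket_skew) fact
  then have "scale 2 (bracket u u) = 0"
    by (metis add.right_inverse scale_left_distrib one_add_one scale_one)
  then show ?thesis
    by simp
qed

text \<open>The locale provides a finite spanning set only; a basis \<open>D\<close> gives access to
  the dimension theory of \<open>finite_dimensional_vector_space\<close>.\<close>

lemma finite_dimensional_basis: "\<exists>D. finite_dimensional_vector_space scale D"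
proof -
  obtain S where S: "finite S" "span S = UNIV"
    using finite_dimensional by blast
  obtain D where D: "independent D" "UNIV \<subseteq> span D"
    using basis_exists[of UNIV] by blast
  have "finite D"
    using independent_span_bound[OF S(1) D(1)] S(2) by simp
  with D have "finite_dimensional_vector_space scale D"
    by unfold_locales auto
  then show ?thesis ..
qed

lemma dim_part_sum: "dim (part 0) + dim (part 1) = dim UNIV"
proof -
  obtain D where "finite_dimensional_vector_space scale D"
    using finite_dimensional_basis by blast
  then interpret finite_dimensional_vector_space scale D .
  have "{u + w |u w. u \<in> part 0 \<and> w \<in> part 1} = UNIV"
    using part_sum by blast
  then show ?thesis
    using dim_sums_Int[OF subspace_part subspace_part, of 0 1] part_inter by simp
qed

text \<open>The bracket is alternating on the even part, so it vanishes on proportional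
  vectors.\<close>

lemma independent_if_bracket_nonzero:
  assumes "u \<in> part 0" "v \<in> part 0" "bracket u v \<noteq> 0"
  shows "u \<noteq> v" "independent {u, v}"
proof -
  show "u \<noteq> v"
    using assms bracket_even_self by auto
  have "u \<notin> span {v}"
    using assms by (auto simp: span_singleton bracket_simps bracket_even_self)
  moreover have "v \<noteq> 0"
    using assms by (auto simp: bracket_simps)
  ultimately show "independent {u, v}"
    by (simp add: independent_insert \<open>u \<noteq> v\<close>)
qed

text \<open>If the bracket of \<open>u\<close> and \<open>v\<close> is \<open>z = a u + b v\<close>, then \<open>[u, z] = b z\<close> and \<open>[v, z] = - a z\<close>.\<close>

lemma normalised_even_pair:
  assumes u: "u \<in> part 0" and v: "v \<in> part 0" and nz: "bracket u v \<noteq> 0"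
    and sp: "part 0 \<subseteq> span {u, v}"
  obtains x y where "x \<in> part 0" "y \<in> part 0" "bracket x y = y" "y \<noteq> 0"
proof -
  define z where "z = bracket u v"
  have z: "z \<in> part 0"
    using bracket_grading[OF u v] by (simp add: z_def)
  then have "z \<in> span {u, v}"
    using sp by blast
  then obtain a b where ab: "z = scale a u + scale b v"
    by (auto simp: span_insert algebra_simps)
  have uz: "bracket u z = scale b z"
    by (subst ab) (simp add: bracket_simps bracket_even_self u z_def)
  have vz: "bracket v z = scale (- a) z"
    by (subst ab) (simp add: bracket_simps bracket_even_self v bracket_skew[OF u v] z_def)
  have "a \<noteq> 0 \<or> b \<noteq> 0"
    using ab nz by (auto simp: z_def)
  then show thesis
  proof
    assume "b \<noteq> 0"
    with uz u z nz show thesis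
      by (intro that[of "scale (1 / b) u" z])
        (auto simp: bracket_simps z_def subspace_scale[OF subspace_part])
  next
    assume "a \<noteq> 0"
    with vz v z nz show thesis
      by (intro that[of "scale (- 1 / a) v" z])
        (auto simp: bracket_simps z_def subspace_scale[OF subspace_part] subspace_neg[OF subspace_part])
  qed
qed

end

section \<open>Duality between the even and the odd part\<close>

context odd_quadratic_lie_superalgebra
begin

lemmas form_left = form_linear_left[unfolded linear_iff_module_hom]
lemmas form_right = form_linear_right[unfolded linear_iff_module_hom]

lemmas form_simps =
  module_hom.add[OF form_left] module_hom.add[OF form_right]
  module_hom.scale[OF form_left] module_hom.scale[OF form_right]
  module_hom.diff[OF form_left] module_hom.diff[OF form_right]
  module_hom.neg[OF form_left] module_hom.neg[OF form_right]
  module_hom.zero[OF form_left] module_hom.zero[OF form_right]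

lemma form_commute: "\<lbrakk>u \<in> part 0; v \<in> part 1\<rbrakk> \<Longrightarrow> form v u = form u v"
  using form_supersymmetric[of u 0 v 1] by (simp add: super_sign_def)

text \<open>Two even vectors pair to zero because the form is odd, so non-degeneracy needs testing
  against odd vectors only.\<close>

lemma even_eq_0I:
  assumes "u \<in> part 0" "\<And>w. w \<in> part 1 \<Longrightarrow> form u w = 0"
  shows "u = 0"
proof (rule form_nondegenerate)
  fix v
  obtain v0 v1 where "v0 \<in> part 0" "v1 \<in> part 1" "v = v0 + v1"
    using part_sum by blast
  then show "form u v = 0"
    using assms form_odd by (simp add: form_simps)
qed

lemma odd_eq_0I:
  assumes "w \<in> part 1" "\<And>u. u \<in> part 0 \<Longrightarrow> form u w = 0"
  shows "w = 0"
proof (rule form_nondegenerate)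
  fix v
  obtain v0 v1 where "v0 \<in> part 0" "v1 \<in> part 1" "v = v0 + v1"
    using part_sum by blast
  then show "form w v = 0"
    using assms form_odd form_commute by (simp add: form_simps)
qed

text \<open>If the odd part were at most a line, a single linear functional would be injective on
  the even part, contradicting the independence of \<open>a\<close> and \<open>b\<close>. This lower
  bound on the odd part and its even counterpart add up to the total dimension 4, which forces
  equality in both.\<close>

lemma two_le_dim_odd:
  assumes a: "a \<in> part 0" and b: "b \<in> part 0" and "a \<noteq> b" "independent {a, b}"
  shows "2 \<le> dim (part 1)"
proof (rule ccontr)
  assume "\<not> 2 \<le> dim (part 1)"
  then have "dim (part 1) = 0 \<or> dim (part 1) = 1"
    by linarith
  obtain D where FD: "finite_dimensional_vector_space scale D"
    using finite_dimensional_basis by blast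
  obtain W where W: "W \<subseteq> part 1" "independent W" "part 1 \<subseteq> span W" "card W = dim (part 1)"
    using basis_exists by blast
  have "finite W"
    using finite_dimensional_vector_space.finiteI_independent[OF FD] W(2) by blast
  \<comment> \<open>The inclusion treats dimension 0 and dimension 1 at once: \<open>W\<close> may
    be empty.\<close>
  with W(4) \<open>dim (part 1) = 0 \<or> dim (part 1) = 1\<close> obtain w where "W \<subseteq> {w}"
    by (auto simp: card_1_singleton_iff)
  with W(3) have "part 1 \<subseteq> span {w}"
    using span_mono by blast
  then have zero: "u = 0" if "u \<in> part 0" "form u w = 0" for u
    using that by (intro even_eq_0I) (auto simp: span_singleton form_simps)
  have indep: "a \<notin> span {b}" "b \<noteq> 0"
    using assms by (auto simp: independent_insert)
  \<comment> \<open>The coefficients are chosen to make the pairing with \<open>w\<close> cancel, so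
    \<open>zero\<close> turns this combination into a linear relation between \<open>a\<close> and
    \<open>b\<close>.\<close>
  have "scale (form b w) a - scale (form a w) b = 0"
    using a b by (intro zero subspace_diff subspace_scale subspace_part) (auto simp: form_simps)
  then have eq: "scale (form b w) a = scale (form a w) b"
    by simp
  have "form b w \<noteq> 0"
    using zero[OF b] indep(2) by blast
  then have "a = scale (form a w / form b w) b"
    using arg_cong[OF eq, of "scale (1 / form b w)"] by simp
  then show False
    using indep(1) by (metis span_scale span_base singletonI)
qed

text \<open>Supplies one vector of the dual basis; exchanging \<open>x\<close> and \<open>y\<close>
  supplies the other. An odd vector in the kernel of \<open>form x\<close> that does not pair to
  zero with \<open>y\<close> only has to be rescaled.\<close>

lemma dual_pair:
  assumes x: "x \<in> part 0" and y: "y \<in> part 0" and y0: "y \<noteq> 0" and sp: "part 0 \<subseteq> span {x, y}"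
    and dim1: "dim (part 1) = 2"
  shows "\<exists>w\<in>part 1. form x w = 0 \<and> form y w = 1"
proof -
  obtain W where W: "W \<subseteq> part 1" "independent W" "card W = 2"
    using basis_exists[of "part 1"] dim1 by metis
  then obtain p q where pq: "W = {p, q}" "p \<noteq> q"
    by (meson card_2_iff)
  have p: "p \<in> part 1" and q: "q \<in> part 1"
    using W pq by auto
  have indep: "p \<notin> span {q}" "q \<noteq> 0"
    using W pq by (auto simp: independent_insert)
  have zero: "w = 0" if "w \<in> part 1" "form x w = 0" "form y w = 0" for w
  proof (rule odd_eq_0I[OF that(1)])
    fix u assume "u \<in> part 0"
    with sp obtain a b where "u = scale a x + scale b y"
      by (auto simp: span_insert algebra_simps)
    with that show "form u w = 0"
      by (simp add: form_simps)
  qed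
  \<comment> \<open>The standard element of the kernel of \<open>form x\<close> on the span of
    \<open>p\<close> and \<open>q\<close>.\<close>
  define w where "w = scale (form x q) p - scale (form x p) q"
  have w: "w \<in> part 1"
    unfolding w_def by (intro subspace_diff subspace_scale subspace_part p q)
  have xw: "form x w = 0"
    by (simp add: w_def form_simps)
  show ?thesis
  proof (cases "form y w = 0")
    case False
    with w xw show ?thesis
      by (intro bexI[of _ "scale (1 / form y w) w"])
        (auto simp: form_simps subspace_scale[OF subspace_part])
  next
    case True
    \<comment> \<open>If \<open>w\<close> degenerates, independence of \<open>p\<close> and
      \<open>q\<close> gives \<open>form x q = 0\<close>, so \<open>q\<close> itself lies in the
      kernel and replaces \<open>w\<close>.\<close>
    then have "w = 0"
      using zero[OF w xw] by blast
    then have eq: "scale (form x q) p = scale (form x p) q"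
      by (simp add: w_def)
    have xq: "form x q = 0"
    proof (rule ccontr)
      assume "form x q \<noteq> 0"
      then have "p = scale (form x p / form x q) q"
        using arg_cong[OF eq, of "scale (1 / form x q)"] by simp
      then show False
        using indep(1) by (metis span_scale span_base singletonI)
    qed
    have "form y q \<noteq> 0"
      using zero[OF q xq] indep(2) by blast
    with xq q show ?thesis
      by (intro bexI[of _ "scale (1 / form y q) q"])
        (auto simp: form_simps subspace_scale[OF subspace_part])
  qed
qed

end

section \<open>Structure constants in a basis adapted to the form\<close>

locale adapted_basis = odd_quadratic_lie_superalgebra +
  fixes x0 y0 x1 y1
  assumes even: "x0 \<in> part 0" "y0 \<in> part 0" and odd: "x1 \<in> part 1" "y1 \<in> part 1"
    and span_even: "part 0 \<subseteq> span {x0, y0}"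
    and dual: "form x0 x1 = 1" "form x0 y1 = 0" "form y0 x1 = 0" "form y0 y1 = 1"
    and bracket_x0_y0: "bracket x0 y0 = y0"
begin

lemma dual': "form x1 x0 = 1" "form y1 x0 = 0" "form x1 y0 = 0" "form y1 y0 = 1"
  using form_commute[OF even(1) odd(1)] form_commute[OF even(1) odd(2)]
    form_commute[OF even(2) odd(1)] form_commute[OF even(2) odd(2)] dual
  by simp_all

lemmas isotropic =
  form_odd[OF even(1) even(1)] form_odd[OF even(1) even(2)]
  form_odd[OF even(2) even(1)] form_odd[OF even(2) even(2)]
  form_odd[OF odd(1) odd(1)] form_odd[OF odd(1) odd(2)]
  form_odd[OF odd(2) odd(1)] form_odd[OF odd(2) odd(2)]

lemma even_expand:
  assumes "u \<in> part 0"
  shows "u = scale (form u x1) x0 + scale (form u y1) y0"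
proof -
  obtain a b where "u = scale a x0 + scale b y0"
    using assms span_even by (auto simp: span_insert algebra_simps)
  then show ?thesis
    by (simp add: form_simps dual)
qed

text \<open>That \<open>x1\<close> and \<open>y1\<close> span the odd part follows from duality: the
  difference of the two sides pairs to zero with \<open>x0\<close> and \<open>y0\<close>, hence with
  every even vector.\<close>

lemma odd_expand:
  assumes w: "w \<in> part 1"
  shows "w = scale (form x0 w) x1 + scale (form y0 w) y1"
proof -
  have "w - (scale (form x0 w) x1 + scale (form y0 w) y1) = 0" (is "?d = 0")
  proof (rule odd_eq_0I)
    show "?d \<in> part 1"
      by (intro subspace_diff subspace_add subspace_scale subspace_part w odd)
    show "form u ?d = 0" if "u \<in> part 0" for u
      by (subst even_expand[OF that]) (simp add: form_simps dual)
  qed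
  then show ?thesis
    by simp
qed

lemma expand:
  "v = scale (form v x1) x0 + scale (form v y1) y0 + scale (form x0 v) x1 + scale (form y0 v) y1"
proof -
  obtain u w where uw: "u \<in> part 0" "w \<in> part 1" "v = u + w"
    using part_sum by blast
  have "form w x1 = 0" "form w y1 = 0" "form x0 u = 0" "form y0 u = 0"
    using form_odd uw even odd by blast+
  then show ?thesis
    using even_expand[OF uw(1)] odd_expand[OF uw(2)] uw(3) by (simp add: form_simps add.assoc)
qed

lemma bracket_y0_x0: "bracket y0 x0 = - y0"
  using bracket_skew[OF even] bracket_x0_y0 by simp

lemma bracket_even_odd:
  "bracket x0 x1 = 0" "bracket x0 y1 = - y1" "bracket y0 x1 = 0" "bracket y0 y1 = x1"
proof -
  \<comment> \<open>The coefficients of \<open>bracket u w\<close> are its pairings with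
    \<open>x0\<close> and \<open>y0\<close>; invariance moves \<open>u\<close> to the other side, so
    the even bracket alone determines them.\<close>
  have *: "bracket u w = scale (form (bracket x0 u) w) x1 + scale (form (bracket y0 u) w) y1"
    if "u \<in> part 0" "w \<in> part 1" for u w
    using odd_expand[of "bracket u w"] bracket_grading[OF that] by (simp add: form_invariant)
  show "bracket x0 x1 = 0" "bracket x0 y1 = - y1" "bracket y0 x1 = 0" "bracket y0 y1 = x1"
    by (simp_all add: * even odd bracket_even_self bracket_x0_y0 bracket_y0_x0 form_simps dual)
qed

lemma bracket_odd_even:
  "bracket x1 x0 = 0" "bracket y1 x0 = y1" "bracket x1 y0 = 0" "bracket y1 y0 = - x1"
  using bracket_even_odd bracket_skew even odd by auto

lemma jacobi_even_odd_odd: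
  assumes "u \<in> part 0" "v \<in> part 1" "w \<in> part 1"
  shows "bracket (bracket u v) w + bracket (bracket v w) u - bracket (bracket w u) v = 0"
  using super_jacobi[of u 0 v 1 w 1] assms by (simp add: super_sign_def)

lemma bracket_odd_odd:
  "bracket x1 x1 = 0" "bracket x1 y1 = 0" "bracket y1 x1 = 0" "bracket y1 y1 = 0"
proof -
  have even_bracket: "bracket v w \<in> part 0" if "v \<in> part 1" "w \<in> part 1" for v w
    using bracket_grading[OF that] by simp
  have comm: "bracket y1 x1 = bracket x1 y1"
    using bracket_super_skew[OF odd] by (simp add: super_sign_def)
  define c d where "c = form (bracket y1 y1) x1" and "d = form (bracket y1 y1) y1"
  have yy: "bracket y1 y1 = scale c x0 + scale d y0"
    unfolding c_def d_def by (rule even_expand[OF even_bracket[OF odd(2) odd(2)]])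
  \<comment> \<open>Jacobi for \<open>x0, y1, y1\<close>: since \<open>[x0, y1] = - y1\<close>, the
    bracket \<open>[y1, y1]\<close> has weight -2 under \<open>x0\<close>, while the weights on the
    even part are 0 and 1. The coefficients on the left are \<open>- 2 c\<close> and
    \<open>- 3 d\<close>.\<close>
  have eq: "- scale c x0 - scale d y0 - scale d y0 - scale c x0 - scale d y0 = 0"
    using jacobi_even_odd_odd[OF even(1) odd(2) odd(2)]
    by (simp add: bracket_even_odd bracket_odd_even bracket_simps bracket_even_self even
        bracket_y0_x0 yy algebra_simps)
  have "c = 0"
    using arg_cong[OF eq, of "\<lambda>v. form v x1"] by (simp add: form_simps dual)
  moreover have "d = 0"
    using arg_cong[OF eq, of "\<lambda>v. form v y1"] by (simp add: form_simps dual)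
  ultimately show yy0: "bracket y1 y1 = 0"
    using yy by simp
  \<comment> \<open>Invariance passes from \<open>[x1, y1]\<close> to \<open>[y1, y1] = 0\<close>
    and removes the \<open>y0\<close> component.\<close>
  have "form (bracket x1 y1) y1 = 0"
    by (simp add: form_invariant yy0 form_simps)
  then obtain b where xy: "bracket x1 y1 = scale b x0"
    using even_expand[OF even_bracket[OF odd]] by auto
  \<comment> \<open>Jacobi for \<open>x0, x1, y1\<close> gives \<open>[x1, y1]\<close> weight -1,
    but the remaining multiple of \<open>x0\<close> has weight 0.\<close>
  show xy0: "bracket x1 y1 = 0"
    using jacobi_even_odd_odd[OF even(1) odd]
    by (simp add: bracket_even_odd bracket_odd_even bracket_simps bracket_even_self even comm)
      (simp add: xy bracket_simps bracket_even_self even)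
  show "bracket y1 x1 = 0"
    using comm xy0 by simp
  show "bracket x1 x1 = 0"
    \<comment> \<open>Here \<open>y0\<close> carries \<open>y1\<close> to \<open>x1\<close>: in
      Jacobi for \<open>y0, x1, y1\<close> only \<open>[x1, x1]\<close> survives.\<close>
    using jacobi_even_odd_odd[OF even(2) odd]
    by (simp add: bracket_even_odd bracket_odd_even bracket_simps xy0)
qed

text \<open>Exactly the brackets that arise when invariance moves a factor of
  \<open>bracket u v\<close> onto the basis vector with which it is paired.\<close>

lemma bracket_basis:
  "bracket v x1 = 0"
  "bracket v y1 = scale (form v y1) x1 - scale (form v x1) y1"
  "bracket x0 v = scale (form v y1) y0 - scale (form y0 v) y1"
  "bracket y0 v = scale (form y0 v) x1 - scale (form v x1) y0"
  by (subst expand[of v],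
      simp add: bracket_simps bracket_even_odd bracket_odd_odd bracket_x0_y0 bracket_y0_x0
        bracket_even_self even form_simps)+

section \<open>The isomorphism onto the model\<close>

text \<open>By \<open>expand\<close> these are the coefficients of \<open>v\<close> in the basis
  \<open>x0, y0, x1, y1\<close>. Writing them as pairings lets invariance compute the coordinates of
  a bracket.\<close>

definition coordinates :: "'a \<Rightarrow> complex ^ gen" where
  "coordinates v = (\<chi> i. case i of X0 \<Rightarrow> form v x1 | Y0 \<Rightarrow> form v y1
                              | X1 \<Rightarrow> form x0 v | Y1 \<Rightarrow> form y0 v)"

lemma coordinates_nth:
  "coordinates v $ X0 = form v x1" "coordinates v $ Y0 = form v y1"
  "coordinates v $ X1 = form x0 v" "coordinates v $ Y1 = form y0 v"
  by (simp_all add: coordinates_def)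

lemma linear_coordinates: "Vector_Spaces.linear scale (*s) coordinates"
  by unfold_locales (simp_all add: vec_eq_iff all_gen coordinates_nth form_simps)

lemma bij_coordinates: "bij coordinates"
proof (rule o_bij)
  let ?g = "\<lambda>c. scale (c $ X0) x0 + scale (c $ Y0) y0 + scale (c $ X1) x1 + scale (c $ Y1) y1"
  show "?g \<circ> coordinates = id"
    by (simp add: fun_eq_iff coordinates_nth expand[symmetric])
  show "coordinates \<circ> ?g = id"
    by (simp add: fun_eq_iff vec_eq_iff all_gen coordinates_nth form_simps dual isotropic)
qed

lemma coordinates_part: "coordinates ` part x \<subseteq> model_part x"
  using form_odd even odd
  by (cases x) (auto simp: mem_model_part_0 mem_model_part_1 coordinates_nth)

text \<open>Extends the symmetry to vectors \<open>v\<close> of mixed parity: even-odd pairs commute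
  without sign, and odd-odd pairs vanish.\<close>

lemma form_odd_left: "form x1 v = form v x1" "form y1 v = form v y1"
  by (subst expand[of v], simp add: form_simps isotropic dual dual')+

lemma coordinates_bracket:
  "coordinates (bracket u v) = model_bracket (coordinates u) (coordinates v)"
proof -
  have right: "form (bracket u v) w = form u (bracket v w)" for w
    by (rule form_invariant)
  have left: "form w (bracket u v) = form (bracket w u) v" for w
    by (rule form_invariant[symmetric])
  show ?thesis
    by (simp add: vec_eq_iff all_gen coordinates_nth model_bracket_nth right left bracket_basis
        form_simps form_odd_left)
qed

lemma coordinates_form: "model_form (coordinates u) (coordinates v) = form u v"
proof -
  have "form u v = form (scale (form u x1) x0 + scale (form u y1) y0
                       + scale (form x0 u) x1 + scale (form y0 u) y1) v"
    using expand[of u] by simp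
  then show ?thesis
    by (simp add: model_form_eq coordinates_nth form_simps form_odd_left)
qed

lemma i_isomorphic_model:
  "i_isomorphic scale part bracket form (*s) model_part model_bracket model_form"
  unfolding i_isomorphic_def
  using odd_quadratic_lie_superalgebra_axioms model_odd_quadratic linear_coordinates
    bij_coordinates coordinates_part coordinates_bracket coordinates_form
  by blast

end

section \<open>Existence of an adapted basis in dimension 4\<close>

theorem mainTheorem8:
  fixes scale :: "complex \<Rightarrow> 'v::ab_group_add \<Rightarrow> 'v"
    and \<gg> :: "bit \<Rightarrow> 'v set"
    and bracket :: "'v \<Rightarrow> 'v \<Rightarrow> 'v"
    and B :: "'v \<Rightarrow> 'v \<Rightarrow> complex"
  assumes "odd_quadratic_lie_superalgebra scale \<gg> bracket B"
    and "vector_space.dim scale (UNIV :: 'v set) = 4"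
    and "\<exists>X\<in>\<gg> 0. \<exists>Y\<in>\<gg> 0. bracket X Y \<noteq> 0"
  shows "i_isomorphic scale \<gg> bracket B (*s) model_part model_bracket model_form"
proof -
  interpret odd_quadratic_lie_superalgebra scale \<gg> bracket B
    by fact
  obtain D where "finite_dimensional_vector_space scale D"
    using finite_dimensional_basis by blast
  then interpret fd: finite_dimensional_vector_space scale D .
  have "2 \<le> dim (\<gg> 0)" if "u \<in> \<gg> 0" "v \<in> \<gg> 0" "bracket u v \<noteq> 0" for u v
    using fd.independent_card_le_dim[of "{u, v}" "\<gg> 0"] independent_if_bracket_nonzero[OF that] that
    by simp
  with assms(3) have "2 \<le> dim (\<gg> 0)" "2 \<le> dim (\<gg> 1)"
    using two_le_dim_odd independent_if_bracket_nonzero by blast+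
  then have dim0: "dim (\<gg> 0) = 2" and dim1: "dim (\<gg> 1) = 2"
    using dim_part_sum assms(2) by linarith+
  \<comment> \<open>Now that the even part has dimension 2, two independent vectors in it span
    it.\<close>
  have span_even: "\<gg> 0 \<subseteq> span {u, v}"
    if "u \<in> \<gg> 0" "v \<in> \<gg> 0" "bracket u v \<noteq> 0" for u v
    using fd.card_ge_dim_independent[of "{u, v}" "\<gg> 0"] independent_if_bracket_nonzero[OF that]
      that dim0 by simp
  obtain x y where xy: "x \<in> \<gg> 0" "y \<in> \<gg> 0" "bracket x y = y" "y \<noteq> 0"
    using assms(3) normalised_even_pair span_even by metis
  have sp: "\<gg> 0 \<subseteq> span {x, y}"
    using span_even[OF xy(1,2)] xy(3,4) by simp
  have "x \<noteq> 0"
    using xy(3,4) by (auto simp: bracket_simps)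
  obtain x' where x': "x' \<in> \<gg> 1" "B y x' = 0" "B x x' = 1"
    \<comment> \<open>The roles of \<open>x\<close> and \<open>y\<close> are exchanged here, which
      is why \<open>x\<close> had to be shown nonzero.\<close>
    using dual_pair[OF xy(2,1) \<open>x \<noteq> 0\<close> _ dim1] sp by (auto simp: insert_commute)
  obtain y' where y': "y' \<in> \<gg> 1" "B x y' = 0" "B y y' = 1"
    using dual_pair[OF xy(1,2,4) sp dim1] by blast
  interpret adapted_basis scale \<gg> bracket B x y x' y'
    by unfold_locales (use xy sp x' y' in auto)
  show ?thesis
    by (rule i_isomorphic_model)
qed

end
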